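(* Assume the Setup below and $|n-p-1|>1$. Then, almost surely: (1) for either choice $\hat\alpha=c$ (with $c_0=0$) or $\hat\alpha=c\,\mathrm{tr}(W)$ (with $c_0=c$), $\hat b_S\to\min\{(n-1)^2+(n-1)-2,\ p^2+p-2\}$ as $c\to0$; (2) as $c\to\infty$, $\hat b_S\to-2$ if $\hat\alpha=c$, and $\hat b_S\to0$ if $\hat\alpha=c\,\mathrm{tr}(W)$.
   Context: Setup. Let $n\ge 2$, $p\ge1$. Let $X=(x_1,\dots,x_n)$ be a random $p\times n$ matrix whose columns are independent with $x_i\sim\mathcal N_p(\theta_i,\Sigma)$, where $\Sigma$ is a known $p\times p$ positive definite matrix and $\Theta\in\mathbb R^{p\times n}$. Let $\bar x=n^{-1}\sum_j x_j$, $\bar X=\bar x\,1_n^\top$, and $W=(X-\bar X)(X-\bar X)^\top\Sigma^{-1}$. The ridge statistic is $\hat\alpha=c$ or $\hat\alpha=c\,\mathrm{tr}(W)$ with a constant $c>0$; correspondingly $c_0=0$ or $c_0=c$. Put $V=(W+\hat\alpha I_p)^{-1}$ and define the estimated weights $$\hat a_S=\frac{(n-p-1)\mathrm{tr}(V)+\hat\alpha(\mathrm{tr}V)^2}{\mathrm{tr}(V^2W)}-(2c_0+1),\qquad \hat b_S=\{(n-1)p-2\}-\mathrm{tr}(VW)\,\hat a_S.$$ *)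

theory Defs
  imports "HOL-Probability.Probability"
begin

text \<open>Matrices: a p x n matrix is an element of real^'n^'p (rows indexed by 'p,
 columns by 'n); p = CARD('p), n = CARD('n).\<close>

definition pos_def_mat :: "real^'p^'p \<Rightarrow> bool" where
  "pos_def_mat S \<longleftrightarrow> transpose S = S \<and> (\<forall>x. x \<noteq> 0 \<longrightarrow> x \<bullet> (S *v x) > 0)"

text \<open>Density of N_p(mu, Sigma) at x.\<close>
definition mvn_density :: "real^'p^'p \<Rightarrow> real^'p \<Rightarrow> real^'p \<Rightarrow> real" where
  "mvn_density S mu x =
     exp (- ((x - mu) \<bullet> (matrix_inv S *v (x - mu))) / 2)
     / sqrt ((2 * pi) ^ CARD('p) * det S)"

text \<open>Law of X = (x_1,...,x_n) with independent columns x_i ~ N_p(theta_i, Sigma).\<close>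
definition data_law :: "real^'p^'p \<Rightarrow> real^'n^'p \<Rightarrow> (real^'n^'p) measure" where
  "data_law S Theta = density lborel
     (\<lambda>X. ennreal (\<Prod>i\<in>UNIV. mvn_density S (column i Theta) (column i X)))"

definition Xbar :: "real^'n^'p \<Rightarrow> real^'n^'p" where
  "Xbar X = (\<chi> j i. (\<Sum>k\<in>UNIV. X$j$k) / real CARD('n))"

definition Wmat :: "real^'p^'p \<Rightarrow> real^'n^'p \<Rightarrow> real^'p^'p" where
  "Wmat S X = ((X - Xbar X) ** transpose (X - Xbar X)) ** matrix_inv S"

definition Vmat :: "real^'p^'p \<Rightarrow> real^'n^'p \<Rightarrow> real \<Rightarrow> real^'p^'p" where
  "Vmat S X a = matrix_inv (Wmat S X + a *\<^sub>R mat 1)"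

text \<open>hat a_S for ridge value a (= hat alpha) and constant c0.\<close>
definition aS :: "real^'p^'p \<Rightarrow> real^'n^'p \<Rightarrow> real \<Rightarrow> real \<Rightarrow> real" where
  "aS S X a c0 =
    (let W = Wmat S X; V = Vmat S X a;
         n = real CARD('n); p = real CARD('p) in
     ((n - p - 1) * trace V + a * (trace V)^2) / trace (V ** V ** W) - (2 * c0 + 1))"

definition bS :: "real^'p^'p \<Rightarrow> real^'n^'p \<Rightarrow> real \<Rightarrow> real \<Rightarrow> real" where
  "bS S X a c0 =
    (let W = Wmat S X; V = Vmat S X a;
         n = real CARD('n); p = real CARD('p) in
     ((n - 1) * p - 2) - trace (V ** W) * aS S X a c0)"

end

theory Submission
  imports Defs "HOL-Computational_Algebra.Polynomial"
begin

text \<open>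
  Write \<open>V = (W + \<alpha> I)\<^sup>-\<^sup>1\<close>; then \<open>b\<^sub>S\<close> is a rational function of \<open>\<alpha>\<close>, \<open>tr V\<close>, \<open>tr (V W)\<close> and
  \<open>tr (V\<^sup>2 W)\<close>. As \<open>\<alpha> \<rightarrow> \<infinity>\<close>, \<open>V = \<alpha>\<^sup>-\<^sup>1 (I + \<alpha>\<^sup>-\<^sup>1 W)\<^sup>-\<^sup>1 \<approx> \<alpha>\<^sup>-\<^sup>1 I\<close>, which gives the limits \<open>-2\<close> and \<open>0\<close>.
  As \<open>\<alpha> \<rightarrow> 0\<close> the rank of \<open>W = Y Y\<^sup>T \<Sigma>\<^sup>-\<^sup>1\<close>, \<open>Y = X - X\<^bsub>bar\<^esub>\<close>, decides. If \<open>p < n\<close>, then \<open>Y Y\<^sup>T\<close> is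
  almost surely invertible, \<open>V\<close> converges and \<open>tr (V W) \<rightarrow> p\<close>. If \<open>p \<ge> n\<close>, then almost surely the
  kernel of \<open>Y\<close> consists of the constant vectors only, \<open>K = Y\<^sup>T \<Sigma>\<^sup>-\<^sup>1 Y + n\<^sup>-\<^sup>1 1 1\<^sup>T\<close> is invertible and
  \<open>tr V = (p - n + 1) / \<alpha> + \<psi>(\<alpha>)\<close> with \<open>\<psi> \<rightarrow> tr K\<^sup>-\<^sup>1 - 1 > 0\<close>; the pole cancels in \<open>a\<^sub>S\<close> because
  \<open>p - n + 1\<close> is a root of \<open>m\<^sup>2 + (n - p - 1) m\<close>.
  Both "almost surely" claims say that a polynomial in the entries of \<open>X\<close> which is nonzero at some
  point does not vanish; its zero set meets every ray from that point in finitely many points, hence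
  is Lebesgue-null, and the law of \<open>X\<close> has a density.
\<close>

section \<open>Matrices\<close>

lemma matrix_add_rdistrib: "((A::'a::semiring_1^'n^'m) + B) ** C = A ** C + B ** C"
  by (vector matrix_matrix_mult_def sum.distrib[symmetric] distrib_right)

lemma matrix_diff_ldistrib: "(A::'a::ring_1^'n^'m) ** (B - C) = A ** B - A ** C"
  by (vector matrix_matrix_mult_def sum_subtractf[symmetric] right_diff_distrib)

lemma matrix_diff_rdistrib: "((A::'a::ring_1^'n^'m) - B) ** C = A ** C - B ** C"
  by (vector matrix_matrix_mult_def sum_subtractf[symmetric] left_diff_distrib)

lemma matrix_scaleR_left: "(k *\<^sub>R (A::real^'n^'m)) ** B = k *\<^sub>R (A ** B)"
  by (simp add: scalar_matrix_assoc)

lemma matrix_scaleR_right: "(A::real^'n^'m) ** (k *\<^sub>R B) = k *\<^sub>R (A ** B)"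
  by (simp add: matrix_scalar_ac scalar_matrix_assoc)

lemmas matrix_scaleR = matrix_scaleR_left matrix_scaleR_right

lemma transpose_add: "transpose ((A::'a::semiring_1^'n^'m) + B) = transpose A + transpose B"
  by (simp add: transpose_def vec_eq_iff)

lemma trace_scaleR: "trace (k *\<^sub>R (A::real^'n^'n)) = k * trace A"
  by (simp add: trace_def sum_distrib_left)

lemma matrix_inv_right: "invertible (A::'a::semiring_1^'n^'n) \<Longrightarrow> A ** matrix_inv A = mat 1"
  and matrix_inv_left: "invertible (A::'a::semiring_1^'n^'n) \<Longrightarrow> matrix_inv A ** A = mat 1"
  unfolding invertible_def matrix_inv_def by (metis (mono_tags, lifting) someI_ex)+

lemma matrix_inv_unique_right:
  fixes A B :: "'a::field^'n^'n"
  assumes "A ** B = mat 1"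
  shows "matrix_inv A = B"
proof -
  have inv: "invertible A" using assms invertible_right_inverse by blast
  have "matrix_inv A = matrix_inv A ** (A ** B)" using assms by simp
  also have "\<dots> = B" by (simp add: matrix_mul_assoc matrix_inv_left[OF inv])
  finally show ?thesis .
qed

lemma matrix_inv_unique_left:
  fixes A B :: "'a::field^'n^'n"
  shows "B ** A = mat 1 \<Longrightarrow> matrix_inv A = B"
  using matrix_inv_unique_right matrix_left_right_inverse by blast

lemma transpose_matrix_inv:
  fixes A :: "'a::field^'n^'n"
  assumes "invertible A"
  shows "transpose (matrix_inv A) = matrix_inv (transpose A)"
  by (metis matrix_inv_left[OF assms] matrix_inv_unique_right matrix_transpose_mul transpose_mat)

lemma inner_vector_matrix_mult: "(x::real^'m) \<bullet> (y v* A) = (A *v x) \<bullet> y"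
  unfolding inner_vec_def vector_matrix_mult_def matrix_vector_mult_def
  by (simp add: sum_distrib_left sum_distrib_right mult_ac) (rule sum.swap)

lemma det_gram_nonzero:
  fixes A :: "real^'n^'p"
  assumes "\<And>w. transpose A *v w = 0 \<Longrightarrow> w = 0"
  shows "det (A ** transpose A) \<noteq> 0"
proof -
  have "w = 0" if "(A ** transpose A) *v w = 0" for w
  proof -
    have "w \<bullet> (A *v (transpose A *v w)) = 0"
      using that by (simp add: matrix_vector_mul_assoc del: transpose_matrix_vector)
    then have "(transpose A *v w) \<bullet> (transpose A *v w) = 0"
      by (simp add: inner_vector_matrix_mult inner_commute)
    then show ?thesis using assms by simp
  qed
  then have "invertible (A ** transpose A)"
    unfolding invertible_left_inverse matrix_left_invertible_ker by blast
  then show ?thesis by (simp add: invertible_det_nz)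
qed

lemma pos_def_mat_invertible: "pos_def_mat S \<Longrightarrow> invertible S"
proof -
  assume "pos_def_mat S"
  then have "\<And>x. S *v x = 0 \<Longrightarrow> x = 0" unfolding pos_def_mat_def by force
  then show ?thesis using invertible_left_inverse matrix_left_invertible_ker by blast
qed

lemma pos_def_mat_matrix_inv:
  assumes S: "pos_def_mat S"
  shows "pos_def_mat (matrix_inv S)"
  unfolding pos_def_mat_def
proof (intro conjI allI impI)
  have inv: "invertible S" by (rule pos_def_mat_invertible[OF S])
  show "transpose (matrix_inv S) = matrix_inv S"
    using S by (simp add: transpose_matrix_inv[OF inv] pos_def_mat_def)
  fix x :: "real^'a" assume x: "x \<noteq> 0"
  let ?y = "matrix_inv S *v x"
  have Sy: "S *v ?y = x" by (simp add: matrix_vector_mul_assoc matrix_inv_right[OF inv])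
  then have "?y \<noteq> 0" using x by auto
  then have "?y \<bullet> (S *v ?y) > 0" using S unfolding pos_def_mat_def by blast
  then show "x \<bullet> (matrix_inv S *v x) > 0" using Sy by (simp add: inner_commute)
qed

lemma trace_transpose_mult_self_pos:
  fixes Z :: "real^'n^'p" and M :: "real^'p^'p"
  assumes M: "pos_def_mat M" and Z: "Z \<noteq> 0"
  shows "trace (transpose Z ** M ** Z) > 0"
proof -
  obtain j where j: "column j Z \<noteq> 0"
    using Z by (auto simp: column_def vec_eq_iff)
  have diag: "(transpose Z ** M ** Z) $ i $ i = column i Z \<bullet> (M *v column i Z)" for i
    unfolding matrix_matrix_mult_def matrix_vector_mult_def transpose_def column_def inner_vec_def
    by (simp add: sum_distrib_left sum_distrib_right mult_ac) (subst sum.swap, simp add: mult_ac)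
  have "0 \<le> column i Z \<bullet> (M *v column i Z)" for i
    using M unfolding pos_def_mat_def by (cases "column i Z = 0") (auto intro: less_imp_le)
  then have "0 < (\<Sum>i\<in>UNIV. column i Z \<bullet> (M *v column i Z))"
    using j M unfolding pos_def_mat_def by (intro sum_pos2[where i=j]) auto
  then show ?thesis by (simp add: trace_def diag)
qed

lemma matrix_inv_nth_cramer:
  fixes A :: "real^'n^'n"
  assumes "det A \<noteq> 0"
  shows "matrix_inv A $ k $ j =
    det (\<chi> i l. if l = k then (if i = j then 1 else 0) else A $ i $ l) / det A"
proof -
  have inv: "invertible A" using assms invertible_det_nz by blast
  have "A *v column j (matrix_inv A) = column j (A ** matrix_inv A)"
    by (simp add: vec_eq_iff matrix_vector_mult_def matrix_matrix_mult_def column_def)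
  then have "A *v column j (matrix_inv A) = column j (mat 1)"
    by (simp add: matrix_inv_right[OF inv])
  then have "column j (matrix_inv A) =
      (\<chi> k. det (\<chi> i l. if l = k then column j (mat 1) $ i else A $ i $ l) / det A)"
    using cramer[OF assms] by blast
  then show ?thesis
    by (simp add: column_def mat_def vec_eq_iff cong: if_cong)
qed

lemma tendsto_det:
  "(A \<longlongrightarrow> A0) F \<Longrightarrow> ((\<lambda>x. det (A x :: real^'n^'n)) \<longlongrightarrow> det A0) F"
  unfolding det_def by (intro tendsto_intros)

lemma tendsto_matrix_mult:
  "(A \<longlongrightarrow> A0) F \<Longrightarrow> (B \<longlongrightarrow> B0) F \<Longrightarrow> ((\<lambda>x. A x ** B x :: real^'k^'m) \<longlongrightarrow> A0 ** B0) F"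
  unfolding matrix_matrix_mult_def by (intro tendsto_intros)

lemma tendsto_trace:
  "(A \<longlongrightarrow> A0) F \<Longrightarrow> ((\<lambda>x. trace (A x :: real^'n^'n)) \<longlongrightarrow> trace A0) F"
  unfolding trace_def by (intro tendsto_intros)

lemma eventually_invertible:
  fixes A :: "'a \<Rightarrow> real^'n^'n"
  assumes "(A \<longlongrightarrow> A0) F" "invertible A0"
  shows "\<forall>\<^sub>F x in F. invertible (A x)"
  using tendsto_imp_eventually_ne[OF tendsto_det[OF assms(1)]] assms(2)
  by (simp add: invertible_det_nz)

lemma tendsto_matrix_inv:
  fixes A :: "'a \<Rightarrow> real^'n^'n"
  assumes A: "(A \<longlongrightarrow> A0) F" and inv: "invertible A0"
  shows "((\<lambda>x. matrix_inv (A x)) \<longlongrightarrow> matrix_inv A0) F"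
proof (intro vec_tendstoI)
  fix k j
  have d0: "det A0 \<noteq> 0" using inv invertible_det_nz by blast
  let ?M = "\<lambda>B :: real^'n^'n. \<chi> i l. if l = k then (if i = j then 1 else 0) else B $ i $ l"
  have "((\<lambda>x. ?M (A x)) \<longlongrightarrow> ?M A0) F"
    by (intro tendsto_vec_lambda) (auto intro: tendsto_vec_nth[OF tendsto_vec_nth[OF A]])
  then have "((\<lambda>x. det (?M (A x)) / det (A x)) \<longlongrightarrow> det (?M A0) / det A0) F"
    by (intro tendsto_divide tendsto_det d0 A)
  moreover have "\<forall>\<^sub>F x in F. det (?M (A x)) / det (A x) = matrix_inv (A x) $ k $ j"
    using eventually_invertible[OF A inv]
    by eventually_elim (simp add: matrix_inv_nth_cramer invertible_det_nz)
  ultimately show "((\<lambda>x. matrix_inv (A x) $ k $ j) \<longlongrightarrow> matrix_inv A0 $ k $ j) F"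
    unfolding matrix_inv_nth_cramer[OF d0] by (rule Lim_transform_eventually)
qed

lemma tendsto_matrix_inv_mat1_add:
  assumes "(t \<longlongrightarrow> 0) F"
  shows "((\<lambda>c. matrix_inv (mat 1 + t c *\<^sub>R (W :: real^'n^'n))) \<longlongrightarrow> mat 1) F"
    and eventually_invertible_mat1_add: "\<forall>\<^sub>F c in F. invertible (mat 1 + t c *\<^sub>R W)"
proof -
  have lim: "((\<lambda>c. mat 1 + t c *\<^sub>R W) \<longlongrightarrow> mat 1) F"
    using tendsto_add[OF tendsto_const tendsto_scaleR[OF assms tendsto_const], of "mat 1" W] by simp
  have inv: "invertible (mat 1 :: real^'n^'n)" by (simp add: invertible_def)
  show "((\<lambda>c. matrix_inv (mat 1 + t c *\<^sub>R W)) \<longlongrightarrow> mat 1) F"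
    using tendsto_matrix_inv[OF lim inv] matrix_inv_unique_right[of "mat 1 :: real^'n^'n" "mat 1"]
    by simp
  show "\<forall>\<^sub>F c in F. invertible (mat 1 + t c *\<^sub>R W)"
    by (rule eventually_invertible[OF lim inv])
qed

lemma tendsto_add_scaleR_at_right_0:
  "((\<lambda>a. x + a *\<^sub>R (y :: 'a::real_normed_vector)) \<longlongrightarrow> x) (at_right 0)"
proof -
  have "((\<lambda>a. x + a *\<^sub>R y) \<longlongrightarrow> x + 0 *\<^sub>R y) (at_right 0)"
    by (intro tendsto_intros)
  then show ?thesis by simp
qed

section \<open>Zero sets of polynomial functions\<close>

lemma nn_integral_indicator_root_scalings:
  fixes T :: "'a::euclidean_space set"
  assumes T: "T \<in> sets lebesgue"
  shows "top * emeasure lebesgue T =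
    (\<integral>\<^sup>+x. (\<Sum>n. indicator ((*\<^sub>R) (root DIM('a) (Suc n)) -` T) x) \<partial>lebesgue)"
proof -
  let ?f = "\<lambda>n. root DIM('a) (Suc n)"
  let ?A = "\<lambda>n. (*\<^sub>R) (?f n) -` T"
  have "?f n *\<^sub>R x \<in> T \<Longrightarrow> x \<in> (*\<^sub>R) (1 / ?f n) ` T" for x n
    by (rule image_eqI[of _ _ "?f n *\<^sub>R x"]) auto
  then have vimage_eq_image: "?A n = (*\<^sub>R) (1 / ?f n) ` T" for n
    by auto
  have eq: "(1 / ?f n) ^ DIM('a) = 1 / Suc n" for n
    by (simp add: field_simps)
  have meas: "?A n \<in> sets lebesgue" for n
    using measurable_sets[OF lebesgue_measurable_scaling[of "?f n"] T] by auto
  have "(\<Sum>n. ennreal (1 / Suc n)) = top"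
    using not_summable_harmonic[where 'a=real] summable_Suc_iff[where f="\<lambda>n. 1 / (real n)"]
    by (intro summable_iff_suminf_neq_top) (auto simp add: inverse_eq_divide)
  then have "top * emeasure lebesgue T = (\<Sum>n. (1 / ?f n)^DIM('a) * emeasure lebesgue T)"
    unfolding ennreal_suminf_multc eq by simp
  also have "\<dots> = (\<Sum>n. emeasure lebesgue (?A n))"
    unfolding vimage_eq_image using emeasure_lebesgue_affine[of "1 / ?f n" 0 T for n] by simp
  also have "\<dots> = (\<integral>\<^sup>+ x. (\<Sum>n. indicator (?A n) x) \<partial>lebesgue)"
  proof -
    have "(indicator (?A n) :: 'a \<Rightarrow> ennreal) \<in> borel_measurable lebesgue" for n
      using meas[of n] by (rule borel_measurable_indicator)
    then show ?thesis by (simp only: nn_integral_suminf nn_integral_indicator[OF meas])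
  qed
  finally show ?thesis .
qed

lemma suminf_indicator_scaleR_vimage_le:
  fixes f :: "nat \<Rightarrow> real"
  assumes f: "inj f" "\<And>n. 0 \<le> f n"
    and fin: "finite {c. 0 \<le> c \<and> c *\<^sub>R x \<in> T}" and card: "card {c. 0 \<le> c \<and> c *\<^sub>R x \<in> T} \<le> N"
  shows "(\<Sum>n. indicator ((*\<^sub>R) (f n) -` T) x :: ennreal) \<le> of_nat N"
proof -
  let ?I = "{n. f n *\<^sub>R x \<in> T}"
  have inj: "inj_on f ?I" using f(1) by (rule inj_on_subset) simp
  have sub: "f ` ?I \<subseteq> {c. 0 \<le> c \<and> c *\<^sub>R x \<in> T}" using f(2) by auto
  have finI: "finite ?I" using finite_imageD[OF finite_subset[OF sub fin] inj] .
  have "card ?I \<le> N"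
    using card_image[OF inj] card_mono[OF fin sub] card by linarith
  moreover have "(\<Sum>n. indicator ((*\<^sub>R) (f n) -` T) x :: ennreal) =
      (\<Sum>n\<in>?I. indicator ((*\<^sub>R) (f n) -` T) x)"
    by (rule suminf_finite[OF finI]) (auto simp: indicator_def)
  ultimately show ?thesis by (simp add: indicator_def)
qed

text \<open>
  A version of \<open>starlike_negligible_bounded_gmeasurable\<close> allowing up to \<open>N\<close> points on each ray:
  the sets \<open>T / (n + 1)\<^bsup>1/d\<^esup>\<close> have measures summing to \<open>\<infinity> \<cdot> \<mu> T\<close>, yet cover each point of a
  ball at most \<open>N\<close> times.
\<close>
lemma null_sets_bounded_finite_on_rays:
  fixes T :: "'a :: euclidean_space set"
  assumes T: "T \<in> sets lebesgue" and "bounded T"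
    and fin: "\<And>x. x \<noteq> 0 \<Longrightarrow>
      finite {c. 0 \<le> c \<and> c *\<^sub>R x \<in> T} \<and> card {c. 0 \<le> c \<and> c *\<^sub>R x \<in> T} \<le> N"
  shows "T \<in> null_sets lebesgue"
proof -
  obtain M where "0 < M" "T \<subseteq> ball 0 M"
    using \<open>bounded T\<close> by (auto dest: bounded_subset_ballD)
  let ?f = "\<lambda>n. root DIM('a) (Suc n)"
  let ?A = "\<lambda>n. (*\<^sub>R) (?f n) -` T"
  have less_M: "norm x < M" if "?f n *\<^sub>R x \<in> T" for n x
  proof -
    have "1 * norm x \<le> ?f n * norm x" by (rule mult_mono) auto
    also have "\<dots> < M" using that \<open>T \<subseteq> ball 0 M\<close> by auto
    finally show ?thesis by simp
  qed
  have pw: "(\<Sum>n. indicator (?A n) x) \<le> of_nat N * (indicator (ball 0 M) x :: ennreal)"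
    if x0: "x \<noteq> 0" for x :: 'a
  proof (cases "x \<in> ball 0 M")
    case True
    have "inj ?f" by (auto intro: injI)
    with fin[OF x0] True show ?thesis
      by (simp add: suminf_indicator_scaleR_vimage_le)
  next
    case False
    have "x \<notin> ?A n" for n
    proof
      assume "x \<in> ?A n"
      then have "norm x < M" by (intro less_M[of n]) simp
      with False show False by (simp add: dist_norm)
    qed
    then show ?thesis by (simp add: indicator_def)
  qed
  have null0: "{0::'a} \<in> null_sets lebesgue"
    using negligible_iff_null_sets negligible_sing by blast
  have "top * emeasure lebesgue T = (\<integral>\<^sup>+ x. (\<Sum>n. indicator (?A n) x) \<partial>lebesgue)"
    by (rule nn_integral_indicator_root_scalings[OF T])
  also have "\<dots> \<le> (\<integral>\<^sup>+ x. of_nat N * indicator (ball (0::'a) M) x \<partial>lebesgue)"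
    by (rule nn_integral_mono_AE) (use AE_not_in[OF null0] in \<open>eventually_elim, use pw in auto\<close>)
  also have "\<dots> = of_nat N * emeasure lebesgue (ball (0::'a) M)"
    by (rule nn_integral_cmult_indicator) simp
  also have "\<dots> < top"
    using lmeasurable_ball by (auto simp: fmeasurable_def ennreal_mult_less_top of_nat_less_top)
  finally have "emeasure lebesgue T = 0"
    by (simp add: ennreal_top_mult split: if_split_asm)
  then show "T \<in> null_sets lebesgue"
    unfolding null_sets_def using T by auto
qed

lemma negligible_closed_finite_on_rays:
  fixes S :: "'a :: euclidean_space set"
  assumes "closed S"
    and fin: "\<And>x. x \<noteq> 0 \<Longrightarrow> finite {c. 0 \<le> c \<and> a + c *\<^sub>R x \<in> S} \<and> card {c. 0 \<le> c \<and> a + c *\<^sub>R x \<in> S} \<le> N"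
  shows "negligible S"
proof -
  let ?S = "(+) (-a) ` S"
  have S': "?S = {y. a + y \<in> S}" by (force simp: image_iff)
  have "negligible ?S"
  proof (subst negligible_on_intervals, intro allI)
    fix u v
    have cl: "closed ?S" using \<open>closed S\<close> closed_translation by blast
    show "negligible (?S \<inter> cbox u v)"
      unfolding negligible_iff_null_sets
    proof (rule null_sets_bounded_finite_on_rays)
      show "?S \<inter> cbox u v \<in> sets lebesgue"
        using cl by (intro sets.Int borel_closed[THEN sets_completionI_sets] lmeasurable_cbox[THEN fmeasurableD]) auto
      show "bounded (?S \<inter> cbox u v)" by (simp add: bounded_Int)
      fix x :: 'a assume x0: "x \<noteq> 0"
      have sub: "{c. 0 \<le> c \<and> c *\<^sub>R x \<in> ?S \<inter> cbox u v} \<subseteq> {c. 0 \<le> c \<and> a + c *\<^sub>R x \<in> S}"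
        using S' by auto
      show "finite {c. 0 \<le> c \<and> c *\<^sub>R x \<in> ?S \<inter> cbox u v} \<and> card {c. 0 \<le> c \<and> c *\<^sub>R x \<in> ?S \<inter> cbox u v} \<le> N"
        using fin[OF x0] finite_subset[OF sub] card_mono[OF _ sub] by (meson order_trans)
    qed
  qed
  then show ?thesis using negligible_translation_rev by blast
qed

lemma real_polynomial_function_on_lines:
  assumes "real_polynomial_function f"
  shows "\<exists>d. \<forall>a x. \<exists>q. degree q \<le> d \<and> (\<forall>c. f (a + c *\<^sub>R x) = poly q c)"
  using assms
proof (induction f)
  case (linear f)
  have "f (a + c *\<^sub>R x) = poly [:f a, f x:] c" for a x c
    using linear.hyps by (simp add: linear_simps algebra_simps)
  moreover have "degree [:f a, f x:] \<le> 1" for a x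
    by simp
  ultimately show ?case by blast
next
  case (const k)
  show ?case by (intro exI[of _ 0] allI exI[of _ "[:k:]"]) simp
next
  case (add f g)
  then obtain d e where f: "\<forall>a x. \<exists>q. degree q \<le> d \<and> (\<forall>c. f (a + c *\<^sub>R x) = poly q c)"
      and g: "\<forall>a x. \<exists>q. degree q \<le> e \<and> (\<forall>c. g (a + c *\<^sub>R x) = poly q c)" by blast
  have "\<exists>q. degree q \<le> max d e \<and> (\<forall>c. f (a + c *\<^sub>R x) + g (a + c *\<^sub>R x) = poly q c)" for a x
  proof -
    obtain q r where "degree q \<le> d" "degree r \<le> e" "\<And>c. f (a + c *\<^sub>R x) = poly q c"
        "\<And>c. g (a + c *\<^sub>R x) = poly r c"
      using f g by meson
    moreover have "degree (q + r) \<le> max d e"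
      using calculation(1,2) by (intro degree_add_le) (auto simp: le_max_iff_disj)
    ultimately show ?thesis by (intro exI[of _ "q + r"]) simp
  qed
  then show ?case by blast
next
  case (mult f g)
  then obtain d e where f: "\<forall>a x. \<exists>q. degree q \<le> d \<and> (\<forall>c. f (a + c *\<^sub>R x) = poly q c)"
      and g: "\<forall>a x. \<exists>q. degree q \<le> e \<and> (\<forall>c. g (a + c *\<^sub>R x) = poly q c)" by blast
  have "\<exists>q. degree q \<le> d + e \<and> (\<forall>c. f (a + c *\<^sub>R x) * g (a + c *\<^sub>R x) = poly q c)" for a x
  proof -
    obtain q r where "degree q \<le> d" "degree r \<le> e" "\<And>c. f (a + c *\<^sub>R x) = poly q c"
        "\<And>c. g (a + c *\<^sub>R x) = poly r c"
      using f g by meson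
    moreover have "degree (q * r) \<le> d + e"
      using calculation(1,2) by (intro order_trans[OF degree_mult_le]) auto
    ultimately show ?thesis by (intro exI[of _ "q * r"]) simp
  qed
  then show ?case by blast
qed

lemma negligible_real_polynomial_function_zeros:
  fixes f :: "'a::euclidean_space \<Rightarrow> real"
  assumes f: "real_polynomial_function f" and fa: "f a \<noteq> 0"
  shows "negligible {x. f x = 0}"
proof -
  obtain d where d: "\<And>x. \<exists>q. degree q \<le> d \<and> (\<forall>c. f (a + c *\<^sub>R x) = poly q c)"
    using real_polynomial_function_on_lines[OF f] by blast
  show ?thesis
  proof (rule negligible_closed_finite_on_rays[where a=a and N=d])
    show "closed {x. f x = 0}"
      using continuous_real_polymonial_function[OF f]
      by (intro closed_Collect_eq) (auto intro: continuous_at_imp_continuous_on)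
    fix x :: 'a
    obtain q where q: "degree q \<le> d" "\<And>c. f (a + c *\<^sub>R x) = poly q c"
      using d by blast
    have "q \<noteq> 0" using fa q(2)[of 0] by auto
    moreover have "{c. 0 \<le> c \<and> a + c *\<^sub>R x \<in> {x. f x = 0}} \<subseteq> {c. poly q c = 0}"
      using q(2) by auto
    ultimately show "finite {c. 0 \<le> c \<and> a + c *\<^sub>R x \<in> {x. f x = 0}} \<and>
        card {c. 0 \<le> c \<and> a + c *\<^sub>R x \<in> {x. f x = 0}} \<le> d"
      using poly_roots_finite[of q] card_poly_roots_bound[of q] q(1)
      by (meson card_mono finite_subset order_trans)
  qed
qed

lemma real_polynomial_function_det:
  assumes "\<And>i j. real_polynomial_function (\<lambda>x. A x $ i $ j)"
  shows "real_polynomial_function (\<lambda>x. det (A x :: real^'n^'n))"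
  unfolding det_def
  by (intro real_polynomial_function_sum real_polynomial_function.intros(4) real_polynomial_function.intros(2)
      real_polynomial_function_prod finite_permutations finite assms)

lemma real_polynomial_function_matrix_mult:
  assumes "\<And>i j. real_polynomial_function (\<lambda>x. A x $ i $ j)"
    and "\<And>i j. real_polynomial_function (\<lambda>x. B x $ i $ j)"
  shows "real_polynomial_function (\<lambda>x. (A x ** B x :: real^'k^'m) $ i $ j)"
  unfolding matrix_matrix_mult_def
  by (simp, intro real_polynomial_function_sum real_polynomial_function.intros(4) finite assms)

lemma null_sets_density_of_null_sets:
  assumes A: "A \<in> null_sets M"
  shows "A \<in> null_sets (density M f)"
proof -
  have "(\<integral>\<^sup>+x. f x * indicator A x \<partial>M) \<le> (\<integral>\<^sup>+x. top * indicator A x \<partial>M)"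
    by (intro nn_integral_mono) (auto simp: indicator_def)
  also have "\<dots> = top * emeasure M A" by (rule nn_integral_cmult_indicator) (use A in auto)
  also have "\<dots> = 0" using A by (simp add: null_setsD1)
  finally have "emeasure (density M f) A = 0"
    unfolding density_def emeasure_measure_of_conv by simp
  then show ?thesis using A by (simp add: null_sets_def)
qed

lemma AE_density_lborel_not_in_negligible:
  assumes "negligible N"
  shows "AE x in density lborel f. x \<notin> N"
proof -
  obtain N' where "N' \<in> null_sets lborel" "N \<subseteq> N'"
    using assms by (auto simp: negligible_iff_null_sets null_sets_completion_iff2)
  then show ?thesis
    by (intro AE_I'[OF null_sets_density_of_null_sets]) auto
qed

lemma AE_data_law_real_polynomial_function:
  fixes f :: "real^'n^'p \<Rightarrow> real"
  assumes "real_polynomial_function f" "f a \<noteq> 0"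
  shows "AE X in data_law S Theta. f X \<noteq> 0"
  using AE_density_lborel_not_in_negligible[OF negligible_real_polynomial_function_zeros[OF assms]]
  unfolding data_law_def by simp

section \<open>The centred data matrix\<close>

definition centred :: "real^'n^'p \<Rightarrow> real^'n^'p" where
  "centred X = X - Xbar X"

text \<open>The matrix \<open>n\<^sup>-\<^sup>1 1 1\<^sup>T\<close>, projecting onto the constant vectors.\<close>
definition averaging_mat :: "real^'n^'n" where
  "averaging_mat = (\<chi> i j. 1 / real CARD('n))"

lemma Wmat_centred: "Wmat S X = centred X ** transpose (centred X) ** matrix_inv S"
  by (simp add: Wmat_def centred_def)

lemma centred_mulv_one: "centred X *v 1 = 0"
  by (simp add: centred_def Xbar_def vec_eq_iff matrix_vector_mult_def sum_subtractf)

lemma averaging_mat_mulv: "averaging_mat *v v = (sum (($) v) UNIV / real CARD('n)) *\<^sub>R (1 :: real^'n)"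
  by (simp add: averaging_mat_def vec_eq_iff matrix_vector_mult_def sum_divide_distrib)

lemma centred_averaging_mat: "centred (X :: real^'n^'p) ** averaging_mat = 0"
proof -
  have "(centred X ** averaging_mat) $ i $ j = (centred X *v 1) $ i / real CARD('n)" for i j
    by (simp add: matrix_matrix_mult_def matrix_vector_mult_def averaging_mat_def sum_divide_distrib)
  then show ?thesis by (simp add: vec_eq_iff centred_mulv_one)
qed

lemma averaging_mat_idem: "averaging_mat ** averaging_mat = (averaging_mat :: real^'n^'n)"
  by (simp add: averaging_mat_def matrix_matrix_mult_def vec_eq_iff power2_eq_square[symmetric])
    (simp add: power2_eq_square)

lemma trace_averaging_mat: "trace (averaging_mat :: real^'n^'n) = 1"
  by (simp add: averaging_mat_def trace_def)

lemma transpose_averaging_mat: "transpose (averaging_mat :: real^'n^'n) = averaging_mat"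
  by (simp add: averaging_mat_def transpose_def)

lemma det_averaging_mat:
  assumes "CARD('n) \<ge> 2"
  shows "det (averaging_mat :: real^'n^'n) = 0"
proof -
  obtain i j :: 'n where "i \<noteq> j"
    using assms by (metis card_le_Suc_iff numeral_2_eq_2 insertCI)
  then show ?thesis by (rule det_identical_rows) (simp add: row_def averaging_mat_def)
qed

lemma real_polynomial_function_centred:
  "real_polynomial_function (\<lambda>X. centred X $ i $ j)"
  unfolding centred_def Xbar_def
  by (simp, intro real_polynomial_function_diff real_polynomial_function_divide
      real_polynomial_function_sum finite real_polynomial_function.intros(1)
      bounded_linear_compose[OF bounded_linear_vec_nth bounded_linear_vec_nth])

lemma invertible_gram_plus_averaging_mat:
  fixes Y :: "real^'n^'p" and Q :: "real^'p^'p"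
  assumes Y1: "Y *v 1 = 0" and Q: "pos_def_mat Q"
    and ker: "\<And>v. Y *v v = 0 \<Longrightarrow> \<exists>s. v = s *\<^sub>R 1"
  shows "invertible (transpose Y ** Q ** Y + averaging_mat)"
proof -
  have "v = 0" if Kv: "(transpose Y ** Q ** Y + averaging_mat) *v v = 0" for v
  proof -
    let ?u = "Y *v v" and ?s = "sum (($) v) UNIV"
    have e: "transpose Y *v (Q *v ?u) + (?s / real CARD('n)) *\<^sub>R 1 = 0"
      using Kv by (simp add: matrix_vector_mult_add_rdistrib averaging_mat_mulv
          matrix_vector_mul_assoc[symmetric])
    have "1 \<bullet> (transpose Y *v (Q *v ?u)) = 0"
      by (simp add: inner_vector_matrix_mult Y1)
    moreover have "1 \<bullet> (1 :: real^'n) = real CARD('n)"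
      by (simp add: inner_vec_def)
    ultimately have "1 \<bullet> (transpose Y *v (Q *v ?u) + (?s / real CARD('n)) *\<^sub>R 1) = ?s"
      by (simp add: inner_add_right)
    with e have s0: "?s = 0" by simp
    with e have "v \<bullet> (transpose Y *v (Q *v ?u)) = 0" by simp
    then have "?u \<bullet> (Q *v ?u) = 0"
      by (simp add: inner_vector_matrix_mult)
    then have "?u = 0" using Q unfolding pos_def_mat_def by force
    then obtain c where c: "v = c *\<^sub>R 1" using ker by blast
    with s0 have "c * real CARD('n) = 0" by simp
    with c show "v = 0" by simp
  qed
  then show ?thesis
    unfolding invertible_left_inverse matrix_left_invertible_ker by blast
qed

lemma centred_row_rank_witness:
  assumes "CARD('p) < CARD('n)"
  shows "\<exists>a::real^'n^'p. det (centred a ** transpose (centred a)) \<noteq> 0"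
proof -
  obtain j0 :: 'n where True by blast
  have "card (UNIV :: 'p set) \<le> card (UNIV - {j0} :: 'n set)" using assms by simp
  then obtain h :: "'p \<Rightarrow> 'n" where hs: "h ` UNIV \<subseteq> UNIV - {j0}" and hi: "inj h"
    using card_le_inj[of "UNIV::'p set" "UNIV - {j0}"] by auto
  define a :: "real^'n^'p" where "a = (\<chi> i j. if j = h i then 1 else 0)"
  have Ya: "centred a $ i $ j = (if j = h i then 1 else 0) - 1 / real CARD('n)" for i j
    by (simp add: centred_def Xbar_def a_def)
  have comp: "(transpose (centred a) *v w) $ j =
      (\<Sum>i\<in>UNIV. if j = h i then w $ i else 0) - sum (($) w) UNIV / real CARD('n)" for w j
    by (simp add: matrix_vector_mult_def transpose_def Ya left_diff_distrib sum_subtractf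
        sum_divide_distrib if_distrib[of "\<lambda>x. x * _"] cong: if_cong)
  show ?thesis
  proof (intro exI det_gram_nonzero)
    fix w assume w: "transpose (centred a) *v w = 0"
    have "(\<Sum>i\<in>UNIV. if j0 = h i then w $ i else 0) = 0"
      using hs by (intro sum.neutral) (auto simp: image_subset_iff)
    with w[THEN arg_cong[where f="\<lambda>v. v $ j0"]] have s0: "sum (($) w) UNIV = 0"
      by (simp only: comp) simp
    show "w = 0"
    proof (rule vec_eq_iff[THEN iffD2], rule allI)
      fix i0
      have "(\<Sum>i\<in>UNIV. if h i0 = h i then w $ i else 0) = (\<Sum>i\<in>UNIV. if i0 = i then w $ i else 0)"
        using hi by (intro sum.cong) (auto dest: injD)
      then have "(transpose (centred a) *v w) $ h i0 = w $ i0" by (simp only: comp s0) simp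
      with w show "w $ i0 = 0 $ i0" by simp
    qed
  qed
qed

text \<open>For \<open>n \<le> p\<close> the centred matrix has rank at most \<open>n - 1\<close>; this witness attains it.\<close>
lemma centred_kernel_witness:
  assumes "CARD('n) \<le> CARD('p)"
  shows "\<exists>a::real^'n^'p. \<forall>v. centred a *v v = 0 \<longrightarrow> (\<exists>s. v = s *\<^sub>R 1)"
proof -
  obtain h :: "'n \<Rightarrow> 'p" where hi: "inj h"
    using card_le_inj[of "UNIV::'n set" "UNIV :: 'p set"] assms by auto
  define a :: "real^'n^'p" where "a = (\<chi> i j. if i = h j then 1 else 0)"
  have Ya: "centred a $ h j0 $ j = (if j0 = j then 1 else 0) - 1 / real CARD('n)" for j0 j
  proof -
    have "(\<Sum>k\<in>UNIV. a $ h j0 $ k) = (\<Sum>k\<in>UNIV. if j0 = k then 1 else 0)"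
      unfolding a_def using hi by (intro sum.cong) (auto dest: injD)
    then show ?thesis using hi by (auto simp: centred_def Xbar_def a_def dest: injD)
  qed
  have "v = (sum (($) v) UNIV / real CARD('n)) *\<^sub>R 1" if v: "centred a *v v = 0" for v
  proof (rule vec_eq_iff[THEN iffD2], rule allI)
    fix j0
    have "(centred a *v v) $ h j0 = v $ j0 - sum (($) v) UNIV / real CARD('n)"
      by (simp add: matrix_vector_mult_def Ya left_diff_distrib sum_subtractf sum_divide_distrib
          if_distrib[of "\<lambda>x. x * _"] cong: if_cong)
    with v show "v $ j0 = ((sum (($) v) UNIV / real CARD('n)) *\<^sub>R 1) $ j0" by simp
  qed
  then show ?thesis by blast
qed

lemma AE_det_centred_gram:
  assumes "CARD('p) < CARD('n)"
  shows "AE X in data_law S Theta. det (centred X ** transpose (centred (X::real^'n^'p))) \<noteq> 0"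
proof -
  obtain a :: "real^'n^'p" where "det (centred a ** transpose (centred a)) \<noteq> 0"
    using centred_row_rank_witness[OF assms] by blast
  moreover have "real_polynomial_function (\<lambda>X. det (centred X ** transpose (centred (X::real^'n^'p))))"
    by (intro real_polynomial_function_det real_polynomial_function_matrix_mult)
      (simp_all add: transpose_def real_polynomial_function_centred)
  ultimately show ?thesis by (rule AE_data_law_real_polynomial_function[rotated])
qed

lemma AE_invertible_centred_gram_plus_averaging_mat:
  assumes "CARD('n) \<le> CARD('p)" and Q: "pos_def_mat Q"
  shows "AE X in data_law S Theta.
    invertible (transpose (centred X) ** Q ** centred (X::real^'n^'p) + averaging_mat)"
proof -
  obtain a :: "real^'n^'p" where "\<And>v. centred a *v v = 0 \<Longrightarrow> \<exists>s. v = s *\<^sub>R 1"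
    using centred_kernel_witness[OF assms(1)] by blast
  then have "det (transpose (centred a) ** Q ** centred a + averaging_mat) \<noteq> 0"
    using invertible_gram_plus_averaging_mat[OF centred_mulv_one Q] invertible_det_nz by blast
  moreover have "real_polynomial_function
      (\<lambda>X. det (transpose (centred X) ** Q ** centred (X::real^'n^'p) + averaging_mat))"
    by (intro real_polynomial_function_det)
      (simp add: real_polynomial_function.intros(2,3) real_polynomial_function_matrix_mult
        transpose_def real_polynomial_function_centred)
  ultimately show ?thesis
    by (rule AE_data_law_real_polynomial_function[rotated, THEN AE_mp]) (simp add: invertible_det_nz)
qed

lemma trace_Wmat_pos:
  assumes S: "pos_def_mat S" and Y: "centred X \<noteq> 0"
  shows "trace (Wmat S X) > 0"
proof -
  have "trace (Wmat S X) = trace (centred X ** (transpose (centred X) ** matrix_inv S))"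
    by (simp add: Wmat_centred matrix_mul_assoc)
  also have "\<dots> = trace (transpose (centred X) ** matrix_inv S ** centred X)"
    by (rule trace_mul_sym)
  finally show ?thesis
    using trace_transpose_mult_self_pos[OF pos_def_mat_matrix_inv[OF S] Y] by simp
qed

section \<open>The ridge resolvent\<close>

definition resolvent :: "real^'p^'p \<Rightarrow> real \<Rightarrow> real^'p^'p" where
  "resolvent W a = matrix_inv (W + a *\<^sub>R mat 1)"

lemma resolvent_mult_right:
  assumes "invertible (W + a *\<^sub>R mat 1)"
  shows "resolvent W a ** W = mat 1 - a *\<^sub>R resolvent W a"
proof -
  have "resolvent W a ** (W + a *\<^sub>R mat 1) = mat 1"
    unfolding resolvent_def by (rule matrix_inv_left[OF assms])
  then show ?thesis
    by (simp add: matrix_add_ldistrib matrix_scaleR algebra_simps)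
qed

lemma resolvent_reciprocal:
  assumes "t \<noteq> 0" and "invertible (mat 1 + t *\<^sub>R W)"
  shows "resolvent W (1 / t) = t *\<^sub>R matrix_inv (mat 1 + t *\<^sub>R W)"
  unfolding resolvent_def
proof (rule matrix_inv_unique_right)
  have "(mat 1 + t *\<^sub>R W) ** matrix_inv (mat 1 + t *\<^sub>R W) = mat 1"
    by (rule matrix_inv_right[OF assms(2)])
  then show "(W + (1 / t) *\<^sub>R mat 1) ** (t *\<^sub>R matrix_inv (mat 1 + t *\<^sub>R W)) = mat 1"
    using assms(1) by (simp add: matrix_add_rdistrib matrix_scaleR scaleR_add_right add.commute)
qed

lemma traces_resolvent_reciprocal:
  fixes W :: "real^'p^'p" and t :: real
  defines "B \<equiv> matrix_inv (mat 1 + t *\<^sub>R W)"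
  assumes t: "t \<noteq> 0" and inv: "invertible (mat 1 + t *\<^sub>R W)"
  shows "trace (resolvent W (1 / t)) = t * (real CARD('p) - t * trace (W ** B))"
    and "trace (resolvent W (1 / t) ** W) = t * trace (W ** B)"
    and "trace (resolvent W (1 / t) ** resolvent W (1 / t) ** W) = t^2 * trace (B ** B ** W)"
proof -
  have V: "resolvent W (1 / t) = t *\<^sub>R B"
    unfolding B_def by (rule resolvent_reciprocal[OF t inv])
  have "(mat 1 + t *\<^sub>R W) ** B = mat 1" unfolding B_def by (rule matrix_inv_right[OF inv])
  then have "B = mat 1 - t *\<^sub>R (W ** B)"
    by (simp add: matrix_add_rdistrib matrix_scaleR algebra_simps)
  then have "trace B = real CARD('p) - t * trace (W ** B)"
    by (metis trace_I trace_scaleR trace_sub of_nat_id)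
  then show "trace (resolvent W (1 / t)) = t * (real CARD('p) - t * trace (W ** B))"
    by (simp add: V trace_scaleR)
  show "trace (resolvent W (1 / t) ** W) = t * trace (W ** B)"
    by (simp add: V matrix_scaleR trace_scaleR trace_mul_sym[of B])
  show "trace (resolvent W (1 / t) ** resolvent W (1 / t) ** W) = t^2 * trace (B ** B ** W)"
    by (simp add: V matrix_scaleR trace_scaleR power2_eq_square)
qed

lemma resolvent_gram_plus_averaging_mat:
  fixes Y :: "real^'n^'p" and Q :: "real^'p^'p"
  defines "G \<equiv> transpose Y ** Q ** Y"
  assumes YJ: "Y ** averaging_mat = 0" and a: "a > 0"
    and inv: "invertible (G + averaging_mat + a *\<^sub>R mat 1)"
  shows "resolvent (G + averaging_mat) a ** averaging_mat = (1 / (1 + a)) *\<^sub>R averaging_mat"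
    and "resolvent (G + averaging_mat) a ** G =
      mat 1 - a *\<^sub>R resolvent (G + averaging_mat) a - (1 / (1 + a)) *\<^sub>R averaging_mat"
proof -
  let ?N = "resolvent (G + averaging_mat) a"
  have NK: "?N ** (G + averaging_mat + a *\<^sub>R mat 1) = mat 1"
    unfolding resolvent_def by (rule matrix_inv_left[OF inv])
  have "G ** averaging_mat = 0" unfolding G_def by (simp flip: matrix_mul_assoc add: YJ)
  then have "(G + averaging_mat + a *\<^sub>R mat 1) ** averaging_mat = (1 + a) *\<^sub>R averaging_mat"
    by (simp add: matrix_add_rdistrib matrix_scaleR averaging_mat_idem algebra_simps)
  then have "averaging_mat = (1 + a) *\<^sub>R (?N ** averaging_mat)"
    by (metis NK matrix_mul_assoc matrix_mul_lid matrix_scaleR_right)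
  then have "(1 / (1 + a)) *\<^sub>R averaging_mat = (1 / (1 + a) * (1 + a)) *\<^sub>R (?N ** averaging_mat)"
    by (metis scaleR_scaleR)
  then show NJ: "?N ** averaging_mat = (1 / (1 + a)) *\<^sub>R averaging_mat"
    using a by simp
  show "?N ** G = mat 1 - a *\<^sub>R ?N - (1 / (1 + a)) *\<^sub>R averaging_mat"
    using NK by (simp add: matrix_add_ldistrib matrix_scaleR NJ algebra_simps)
qed

lemma gram_transpose_resolvent_products:
  fixes Y :: "real^'n^'p" and Q :: "real^'p^'p" and a :: real
  defines "G \<equiv> transpose Y ** Q ** Y"
  defines "N \<equiv> resolvent (G + averaging_mat) a"
  defines "P \<equiv> Y ** N ** transpose Y ** Q"
  assumes YJ: "Y ** averaging_mat = 0" and a: "a > 0"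
    and inv: "invertible (G + averaging_mat + a *\<^sub>R mat 1)"
  shows "P ** (Y ** transpose Y ** Q) = Y ** transpose Y ** Q - a *\<^sub>R P"
    and "P ** P = P - a *\<^sub>R (Y ** N ** N ** transpose Y ** Q)"
proof -
  note NG = resolvent_gram_plus_averaging_mat(2)[OF YJ a inv[unfolded G_def], folded G_def N_def]
  have "P ** (Y ** transpose Y ** Q) = Y ** (N ** G) ** (transpose Y ** Q)"
    by (simp add: P_def G_def matrix_mul_assoc)
  then show "P ** (Y ** transpose Y ** Q) = Y ** transpose Y ** Q - a *\<^sub>R P"
    by (simp add: NG P_def matrix_diff_ldistrib matrix_diff_rdistrib matrix_scaleR matrix_mul_assoc YJ)
  have "P ** P = Y ** (N ** G) ** N ** (transpose Y ** Q)"
    by (simp add: P_def G_def matrix_mul_assoc)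
  then show "P ** P = P - a *\<^sub>R (Y ** N ** N ** transpose Y ** Q)"
    by (simp add: NG P_def matrix_diff_ldistrib matrix_diff_rdistrib matrix_scaleR matrix_mul_assoc YJ)
qed

lemma resolvent_gram_transpose:
  fixes Y :: "real^'n^'p" and Q :: "real^'p^'p" and a :: real
  defines "G \<equiv> transpose Y ** Q ** Y"
  defines "N \<equiv> resolvent (G + averaging_mat) a"
  assumes YJ: "Y ** averaging_mat = 0" and a: "a > 0"
    and inv: "invertible (G + averaging_mat + a *\<^sub>R mat 1)"
  shows "resolvent (Y ** transpose Y ** Q) a = (1 / a) *\<^sub>R (mat 1 - Y ** N ** transpose Y ** Q)"
  unfolding resolvent_def
proof (rule matrix_inv_unique_left)
  note PW = gram_transpose_resolvent_products(1)[OF YJ a inv[unfolded G_def], folded G_def N_def]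
  show "((1 / a) *\<^sub>R (mat 1 - Y ** N ** transpose Y ** Q)) ** (Y ** transpose Y ** Q + a *\<^sub>R mat 1)
      = mat 1"
    using a by (simp add: matrix_scaleR matrix_diff_rdistrib matrix_add_ldistrib PW algebra_simps)
qed

lemma traces_resolvent_gram_transpose:
  fixes Y :: "real^'n^'p" and Q :: "real^'p^'p" and a :: real
  defines "G \<equiv> transpose Y ** Q ** Y" and "W \<equiv> Y ** transpose Y ** Q"
  defines "N \<equiv> resolvent (G + averaging_mat) a"
  assumes YJ: "Y ** averaging_mat = 0" and a: "a > 0"
    and inv: "invertible (G + averaging_mat + a *\<^sub>R mat 1)"
  shows "trace (resolvent W a) = (real CARD('p) - (real CARD('n) - 1)) / a + (trace N - 1 / (1 + a))"
    and "trace (resolvent W a ** W) = (real CARD('n) - 1) - a * (trace N - 1 / (1 + a))"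
    and "trace (resolvent W a ** resolvent W a ** W) =
      trace N - a * trace (N ** N) - (1 / (1 + a))^2"
proof -
  let ?P = "Y ** N ** transpose Y ** Q"
  note G = inv[unfolded G_def]
  note NJ = resolvent_gram_plus_averaging_mat(1)[OF YJ a G, folded G_def N_def]
  note NG = resolvent_gram_plus_averaging_mat(2)[OF YJ a G, folded G_def N_def]
  note PW = gram_transpose_resolvent_products(1)[OF YJ a G, folded G_def N_def W_def]
  note PP = gram_transpose_resolvent_products(2)[OF YJ a G, folded G_def N_def]
  have V: "resolvent W a = (1 / a) *\<^sub>R (mat 1 - ?P)"
    unfolding W_def N_def G_def by (rule resolvent_gram_transpose[OF YJ a G])
  have VW: "resolvent W a ** W = ?P"
    using a by (simp add: V PW matrix_scaleR matrix_diff_rdistrib)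
  have "resolvent W a ** ?P = Y ** N ** N ** transpose Y ** Q"
    using a by (simp add: V matrix_scaleR matrix_diff_rdistrib PP)
  then have VVW: "resolvent W a ** resolvent W a ** W = Y ** N ** N ** transpose Y ** Q"
    by (simp add: VW flip: matrix_mul_assoc)
  have trP: "trace ?P = real CARD('n) - a * trace N - 1 / (1 + a)"
  proof -
    have "trace ?P = trace (N ** G)"
      by (metis G_def matrix_mul_assoc trace_mul_sym)
    then show ?thesis by (simp add: NG trace_sub trace_I trace_scaleR trace_averaging_mat)
  qed
  have "trace (Y ** N ** N ** transpose Y ** Q) = trace (N ** (N ** G))"
    by (metis G_def matrix_mul_assoc trace_mul_sym)
  also have "\<dots> = trace N - a * trace (N ** N) - (1 / (1 + a))^2"
    by (simp add: NG NJ matrix_diff_ldistrib matrix_scaleR trace_sub trace_scaleR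
        trace_averaging_mat power2_eq_square)
  finally show "trace (resolvent W a ** resolvent W a ** W) =
      trace N - a * trace (N ** N) - (1 / (1 + a))^2"
    by (simp add: VVW)
  show "trace (resolvent W a ** W) = (real CARD('n) - 1) - a * (trace N - 1 / (1 + a))"
    using a by (simp add: VW trP field_simps)
  have "a * (1 + a) \<noteq> 0" using a by simp
  then show "trace (resolvent W a) = (real CARD('p) - (real CARD('n) - 1)) / a + (trace N - 1 / (1 + a))"
    using a by (simp add: V trace_scaleR trace_sub trace_I trP) (simp add: field_simps)
qed

text \<open>
  As \<open>a \<rightarrow> 0\<^sup>+\<close>, \<open>tr (W + a I)\<^sup>-\<^sup>1\<close> has a pole \<open>m / a\<close> coming from the kernel of \<open>W\<close>;
  its regular part \<open>\<psi>\<close> and \<open>tr ((W + a I)\<^sup>-\<^sup>2 W)\<close> share a nonzero limit.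
\<close>
definition resolvent_expansion :: "real^'p^'p \<Rightarrow> real \<Rightarrow> real \<Rightarrow> bool" where
  "resolvent_expansion W m r \<longleftrightarrow> (\<exists>\<psi> \<psi>0. \<psi>0 \<noteq> 0 \<and> (\<psi> \<longlongrightarrow> \<psi>0) (at_right 0) \<and>
     ((\<lambda>a. trace (resolvent W a ** resolvent W a ** W)) \<longlongrightarrow> \<psi>0) (at_right 0) \<and>
     (\<forall>\<^sub>F a in at_right 0. trace (resolvent W a) = m / a + \<psi> a \<and>
        trace (resolvent W a ** W) = r - a * \<psi> a))"

lemma resolvent_expansion_invertible:
  fixes W :: "real^'p^'p"
  assumes inv: "invertible W" and tr: "trace (matrix_inv W) \<noteq> 0"
  shows "resolvent_expansion W 0 (real CARD('p))"
proof -
  note lim = tendsto_add_scaleR_at_right_0[of W "mat 1"]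
  have V: "(resolvent W \<longlongrightarrow> matrix_inv W) (at_right 0)"
    unfolding resolvent_def by (rule tendsto_matrix_inv[OF lim inv])
  have "((\<lambda>a. trace (resolvent W a ** resolvent W a ** W)) \<longlongrightarrow>
      trace (matrix_inv W ** matrix_inv W ** W)) (at_right 0)"
    by (intro tendsto_trace tendsto_matrix_mult V tendsto_const)
  moreover have "matrix_inv W ** matrix_inv W ** W = matrix_inv W"
    by (simp add: matrix_inv_left[OF inv] flip: matrix_mul_assoc)
  moreover have "\<forall>\<^sub>F a in at_right 0. trace (resolvent W a) = 0 / a + trace (resolvent W a) \<and>
      trace (resolvent W a ** W) = real CARD('p) - a * trace (resolvent W a)"
    using eventually_invertible[OF lim inv]
    by eventually_elim (simp add: resolvent_mult_right trace_sub trace_I trace_scaleR)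
  ultimately show ?thesis
    unfolding resolvent_expansion_def using tendsto_trace[OF V] tr
    by (intro exI[of _ "\<lambda>a. trace (resolvent W a)"] exI[of _ "trace (matrix_inv W)"]) auto
qed

lemma resolvent_expansion_gram_transpose:
  fixes Y :: "real^'n^'p" and Q :: "real^'p^'p"
  defines "K \<equiv> transpose Y ** Q ** Y + averaging_mat" and "W \<equiv> Y ** transpose Y ** Q"
  assumes YJ: "Y ** averaging_mat = 0" and inv: "invertible K" and tr: "trace (matrix_inv K) \<noteq> 1"
  shows "resolvent_expansion W (real CARD('p) - (real CARD('n) - 1)) (real CARD('n) - 1)"
proof -
  define \<psi> where "\<psi> a = trace (resolvent K a) - 1 / (1 + a)" for a
  note lim = tendsto_add_scaleR_at_right_0[of K "mat 1"]
  have N: "(resolvent K \<longlongrightarrow> matrix_inv K) (at_right 0)"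
    unfolding resolvent_def by (rule tendsto_matrix_inv[OF lim inv])
  have "(\<psi> \<longlongrightarrow> trace (matrix_inv K) - 1 / (1 + 0)) (at_right 0)"
    unfolding \<psi>_def by (intro tendsto_intros tendsto_trace N) simp
  then have lim_\<psi>: "(\<psi> \<longlongrightarrow> trace (matrix_inv K) - 1) (at_right 0)" by simp
  have "((\<lambda>a. trace (resolvent K a) - a * trace (resolvent K a ** resolvent K a) - (1 / (1 + a))^2)
      \<longlongrightarrow> trace (matrix_inv K) - 0 * trace (matrix_inv K ** matrix_inv K) - (1 / (1 + 0))^2)
      (at_right 0)"
    by (intro tendsto_intros tendsto_trace tendsto_matrix_mult N) simp
  then have lim_d: "((\<lambda>a. trace (resolvent K a) - a * trace (resolvent K a ** resolvent K a)
      - (1 / (1 + a))^2) \<longlongrightarrow> trace (matrix_inv K) - 1) (at_right 0)"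
    by simp
  have "\<forall>\<^sub>F a in at_right 0. a > 0 \<and> invertible (K + a *\<^sub>R mat 1)"
    using eventually_at_right_less eventually_invertible[OF lim inv] by (rule eventually_conj)
  then have ev: "\<forall>\<^sub>F a in at_right 0.
      trace (resolvent W a) = (real CARD('p) - (real CARD('n) - 1)) / a + \<psi> a \<and>
      trace (resolvent W a ** W) = (real CARD('n) - 1) - a * \<psi> a \<and>
      trace (resolvent K a) - a * trace (resolvent K a ** resolvent K a) - (1 / (1 + a))^2 =
        trace (resolvent W a ** resolvent W a ** W)"
    by eventually_elim
      (use traces_resolvent_gram_transpose[OF YJ] in \<open>simp add: \<psi>_def K_def W_def\<close>)
  have "((\<lambda>a. trace (resolvent W a ** resolvent W a ** W)) \<longlongrightarrow> trace (matrix_inv K) - 1)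
      (at_right 0)"
    by (rule Lim_transform_eventually[OF lim_d]) (use ev in \<open>eventually_elim, simp\<close>)
  then show ?thesis
    unfolding resolvent_expansion_def using tr lim_\<psi> ev
    by (intro exI[of _ \<psi>] exI[of _ "trace (matrix_inv K) - 1"]) (auto elim: eventually_mono)
qed

lemma trace_matrix_inv_gram_pos:
  fixes Y :: "real^'n^'p" and S :: "real^'p^'p"
  assumes S: "pos_def_mat S" and inv: "invertible (Y ** transpose Y)"
  shows "trace (matrix_inv (Y ** transpose Y ** matrix_inv S)) > 0"
proof -
  let ?G = "Y ** transpose Y" and ?Z = "matrix_inv (Y ** transpose Y) ** Y"
  have invS: "invertible S" by (rule pos_def_mat_invertible[OF S])
  have "?G ** matrix_inv S ** (S ** matrix_inv ?G) = ?G ** (matrix_inv S ** S) ** matrix_inv ?G"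
    by (simp add: matrix_mul_assoc)
  then have inv_W: "matrix_inv (?G ** matrix_inv S) = S ** matrix_inv ?G"
    by (intro matrix_inv_unique_right) (simp add: matrix_inv_left[OF invS] matrix_inv_right[OF inv])
  have "transpose (matrix_inv ?G) = matrix_inv ?G"
    by (simp add: transpose_matrix_inv[OF inv] matrix_transpose_mul)
  then have "?Z ** transpose ?Z = matrix_inv ?G ** ?G ** matrix_inv ?G"
    by (simp add: matrix_transpose_mul matrix_mul_assoc)
  then have ZZ: "?Z ** transpose ?Z = matrix_inv ?G"
    by (simp add: matrix_inv_left[OF inv])
  have "?Z \<noteq> 0"
  proof
    assume "?Z = 0"
    moreover have "Y = ?G ** ?Z" by (simp add: matrix_mul_assoc matrix_inv_right[OF inv])
    ultimately have "invertible (0 :: real^'p^'p)" using inv by simp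
    then show False using det_0[where 'a=real and 'n='p] by (simp add: invertible_det_nz)
  qed
  then have "0 < trace (transpose ?Z ** S ** ?Z)" by (rule trace_transpose_mult_self_pos[OF S])
  also have "\<dots> = trace (transpose ?Z ** (S ** ?Z))" by (simp add: matrix_mul_assoc)
  also have "\<dots> = trace ((S ** ?Z) ** transpose ?Z)" by (rule trace_mul_sym)
  also have "\<dots> = trace (S ** (?Z ** transpose ?Z))" by (simp only: matrix_mul_assoc)
  also have "\<dots> = trace (matrix_inv (?G ** matrix_inv S))" by (simp only: ZZ inv_W)
  finally show ?thesis .
qed

lemma trace_matrix_inv_gram_plus_averaging_mat_gt_1:
  fixes Y :: "real^'n^'p" and Q :: "real^'p^'p"
  defines "G \<equiv> transpose Y ** Q ** Y"
  assumes Q: "pos_def_mat Q" and YJ: "Y ** averaging_mat = 0" and Y0: "Y \<noteq> 0"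
    and inv: "invertible (G + averaging_mat)"
  shows "trace (matrix_inv (G + averaging_mat)) > 1"
proof -
  let ?N = "matrix_inv (G + averaging_mat)"
  have NK: "?N ** (G + averaging_mat) = mat 1" by (rule matrix_inv_left[OF inv])
  have "G ** averaging_mat = 0" unfolding G_def by (simp flip: matrix_mul_assoc add: YJ)
  then have "(G + averaging_mat) ** averaging_mat = averaging_mat"
    by (simp add: matrix_add_rdistrib averaging_mat_idem)
  then have NJ: "?N ** averaging_mat = averaging_mat"
    by (metis NK matrix_mul_assoc matrix_mul_lid)
  have "transpose (G + averaging_mat) = G + averaging_mat"
    using Q by (simp add: G_def transpose_add matrix_transpose_mul transpose_averaging_mat
        matrix_mul_assoc pos_def_mat_def)
  then have NT: "transpose ?N = ?N" by (simp add: transpose_matrix_inv[OF inv])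
  have "trace (?N ** ?N ** G) = trace ?N - 1"
  proof -
    have "?N ** ?N ** G = ?N ** (?N ** (G + averaging_mat)) - ?N ** (?N ** averaging_mat)"
      by (simp add: matrix_add_ldistrib matrix_mul_assoc)
    then show ?thesis by (simp add: NK NJ trace_sub trace_averaging_mat)
  qed
  moreover have "Y ** ?N \<noteq> 0"
  proof
    assume "Y ** ?N = 0"
    moreover have "Y = Y ** ?N ** (G + averaging_mat)" by (simp add: NK flip: matrix_mul_assoc)
    ultimately show False using Y0 by simp
  qed
  then have "trace (transpose (Y ** ?N) ** Q ** (Y ** ?N)) > 0"
    by (rule trace_transpose_mult_self_pos[OF Q])
  moreover have "transpose (Y ** ?N) ** Q ** (Y ** ?N) = ?N ** (transpose Y ** Q ** Y) ** ?N"
    by (simp add: NT matrix_transpose_mul matrix_mul_assoc)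
  then have "trace (transpose (Y ** ?N) ** Q ** (Y ** ?N)) = trace (?N ** (G ** ?N))"
    by (simp add: G_def matrix_mul_assoc)
  moreover have "trace (?N ** (G ** ?N)) = trace (?N ** ?N ** G)"
    by (metis trace_mul_sym matrix_mul_assoc)
  ultimately show ?thesis by simp
qed

lemma resolvent_expansion_Wmat_full_rank:
  fixes S :: "real^'p^'p" and X :: "real^'n^'p"
  assumes S: "pos_def_mat S" and d: "det (centred X ** transpose (centred X)) \<noteq> 0"
  shows "resolvent_expansion (Wmat S X) 0 (real CARD('p))"
proof (rule resolvent_expansion_invertible)
  have "invertible (centred X ** transpose (centred X))" using d by (simp add: invertible_det_nz)
  then show "invertible (Wmat S X)" and "trace (matrix_inv (Wmat S X)) \<noteq> 0"
    using trace_matrix_inv_gram_pos[OF S] invertible_mult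
      pos_def_mat_invertible[OF pos_def_mat_matrix_inv[OF S]]
    by (force simp: Wmat_centred)+
qed

lemma resolvent_expansion_Wmat_rank_deficient:
  fixes S :: "real^'p^'p" and X :: "real^'n^'p"
  assumes S: "pos_def_mat S" and Y: "centred X \<noteq> 0"
    and inv: "invertible (transpose (centred X) ** matrix_inv S ** centred X + averaging_mat)"
  shows "resolvent_expansion (Wmat S X)
    (real CARD('p) - (real CARD('n) - 1)) (real CARD('n) - 1)"
  using resolvent_expansion_gram_transpose[OF centred_averaging_mat inv]
    trace_matrix_inv_gram_plus_averaging_mat_gt_1[OF pos_def_mat_matrix_inv[OF S]
      centred_averaging_mat Y inv]
  by (simp add: Wmat_centred)

section \<open>Limits of the weight\<close>

definition b_weight :: "real \<Rightarrow> real^'p^'p \<Rightarrow> real \<Rightarrow> real \<Rightarrow> real" where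
  "b_weight n W a c0 =
    (let V = resolvent W a; p = real CARD('p) in
     ((n - 1) * p - 2) -
       trace (V ** W) * (((n - p - 1) * trace V + a * (trace V)^2) / trace (V ** V ** W) - (2 * c0 + 1)))"

lemma bS_eq_b_weight: "bS S (X::real^'n^'p) a c0 = b_weight (real CARD('n)) (Wmat S X) a c0"
  by (simp add: bS_def aS_def b_weight_def Vmat_def resolvent_def Let_def)

lemma tendsto_b_weight_at_right_0:
  fixes W :: "real^'p^'p" and al k :: "'a \<Rightarrow> real"
  assumes exp: "resolvent_expansion W m r" and m: "(n - real CARD('p) - 1) * m + m^2 = 0"
    and al: "filterlim al (at_right 0) F" and k: "(k \<longlongrightarrow> 0) F"
  shows "((\<lambda>c. b_weight n W (al c) (k c)) \<longlongrightarrow>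
    (n - 1) * real CARD('p) - 2 - r * (n - real CARD('p) - 1 + 2 * m - 1)) F"
proof -
  let ?p = "real CARD('p)" and ?d = "\<lambda>a. trace (resolvent W a ** resolvent W a ** W)"
  obtain \<psi> \<psi>0 where \<psi>0: "\<psi>0 \<noteq> 0" and \<psi>: "(\<psi> \<longlongrightarrow> \<psi>0) (at_right 0)" and d: "(?d \<longlongrightarrow> \<psi>0) (at_right 0)"
    and ev: "\<forall>\<^sub>F a in at_right 0. trace (resolvent W a) = m / a + \<psi> a \<and>
      trace (resolvent W a ** W) = r - a * \<psi> a"
    using exp unfolding resolvent_expansion_def by blast
  define g where "g a c0 = (n - 1) * ?p - 2 - (r - a * \<psi> a) *
    (((n - ?p - 1 + 2 * m) * \<psi> a + a * (\<psi> a)^2) / ?d a - (2 * c0 + 1))" for a c0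
  have "\<forall>\<^sub>F a in at_right 0. \<forall>c0. b_weight n W a c0 = g a c0"
    using ev eventually_at_right_less[of 0]
  proof eventually_elim
    case (elim a)
    \<comment> \<open>the pole of \<open>tr V\<close> cancels because \<open>m\<close> is a root of \<open>m\<^sup>2 + (n - p - 1) m\<close>\<close>
    have "(n - ?p - 1) * trace (resolvent W a) + a * (trace (resolvent W a))^2 =
        ((n - ?p - 1) * m + m^2) / a + (n - ?p - 1 + 2 * m) * \<psi> a + a * (\<psi> a)^2"
      unfolding elim(1)[THEN conjunct1] using elim(2) by (simp add: field_simps power2_eq_square)
    then show ?case using elim m by (simp add: b_weight_def g_def Let_def)
  qed
  then have ev_g: "\<forall>\<^sub>F c in F. b_weight n W (al c) (k c) = g (al c) (k c)"
    by (auto intro: eventually_mono[OF eventually_compose_filterlim[OF _ al]])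
  have a0: "(al \<longlongrightarrow> 0) F" using al by (simp add: filterlim_at)
  have "((\<lambda>c. g (al c) (k c)) \<longlongrightarrow> (n - 1) * ?p - 2 - (r - 0 * \<psi>0) *
      (((n - ?p - 1 + 2 * m) * \<psi>0 + 0 * \<psi>0^2) / \<psi>0 - (2 * 0 + 1))) F"
    unfolding g_def
    by (intro tendsto_intros filterlim_compose[OF \<psi> al] filterlim_compose[OF d al] a0 k \<psi>0)
  then have "((\<lambda>c. g (al c) (k c)) \<longlongrightarrow>
      (n - 1) * ?p - 2 - r * (n - ?p - 1 + 2 * m - 1)) F"
    using \<psi>0 by simp
  then show ?thesis
    by (rule Lim_transform_eventually[OF _ eventually_mono[OF ev_g]]) (rule sym)
qed

lemma tendsto_b_weight_at_top:
  fixes W :: "real^'p^'p" and al k :: "'a \<Rightarrow> real"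
  assumes W: "trace W \<noteq> 0" and al: "filterlim al at_top F"
    and k: "((\<lambda>c. trace W * (2 * k c + 1) / al c) \<longlongrightarrow> \<kappa>) F"
  shows "((\<lambda>c. b_weight n W (al c) (k c)) \<longlongrightarrow> \<kappa> - 2) F"
proof -
  let ?p = "real CARD('p)"
  define t where "t c = 1 / al c" for c
  define B where "B c = matrix_inv (mat 1 + t c *\<^sub>R W)" for c
  define u where "u c = trace (W ** B c)" for c
  define d where "d c = trace (B c ** B c ** W)" for c
  have t0: "(t \<longlongrightarrow> 0) F"
    unfolding t_def by (rule tendsto_divide_0[OF tendsto_const filterlim_at_top_imp_at_infinity[OF al]])
  have Blim: "(B \<longlongrightarrow> mat 1) F"
    unfolding B_def[abs_def] by (rule tendsto_matrix_inv_mat1_add[OF t0])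
  have "(u \<longlongrightarrow> trace (W ** mat 1)) F" and "(d \<longlongrightarrow> trace (mat 1 ** mat 1 ** W)) F"
    unfolding u_def[abs_def] d_def[abs_def]
    by (intro tendsto_trace tendsto_matrix_mult tendsto_const Blim)+
  then have u: "(u \<longlongrightarrow> trace W) F" and d: "(d \<longlongrightarrow> trace W) F" by simp_all
  have "\<forall>\<^sub>F c in F. al c > 0 \<and> invertible (mat 1 + t c *\<^sub>R W) \<and> d c \<noteq> 0"
    by (intro eventually_conj eventually_compose_filterlim[OF eventually_gt_at_top al]
        eventually_invertible_mat1_add[OF t0] tendsto_imp_eventually_ne[OF d W])
  then have ev: "\<forall>\<^sub>F c in F. b_weight n W (al c) (k c) = (n - 1) * ?p - 2
      - u c * (?p - t c * u c) * (n - 1 - t c * u c) / d c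
      + (trace W * (2 * k c + 1) / al c) * (u c / trace W)"
  proof eventually_elim
    case (elim c)
    then have "t c \<noteq> 0" and al_t: "al c = 1 / t c" by (simp_all add: t_def)
    note tr = traces_resolvent_reciprocal[OF this(1) elim[THEN conjunct2, THEN conjunct1],
        folded B_def u_def d_def]
    show ?case
      using \<open>t c \<noteq> 0\<close> elim W
      by (simp add: b_weight_def Let_def al_t tr flip: d_def) (simp add: field_simps power2_eq_square)
  qed
  have lim: "((\<lambda>c. (n - 1) * ?p - 2 - u c * (?p - t c * u c) * (n - 1 - t c * u c) / d c
      + (trace W * (2 * k c + 1) / al c) * (u c / trace W)) \<longlongrightarrow>
      (n - 1) * ?p - 2 - trace W * (?p - 0 * trace W) * (n - 1 - 0 * trace W) / trace W
      + \<kappa> * (trace W / trace W)) F"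
    by (intro tendsto_intros u d t0 k W)
  have eq: "(n - 1) * ?p - 2 - trace W * (?p - 0 * trace W) * (n - 1 - 0 * trace W) / trace W
      + \<kappa> * (trace W / trace W) = \<kappa> - 2"
  proof -
    have "trace W * (?p - 0 * trace W) * (n - 1 - 0 * trace W) / trace W = ?p * (n - 1)"
      using W by simp
    then show ?thesis using W by (simp add: algebra_simps)
  qed
  show ?thesis
    by (rule Lim_transform_eventually[OF lim[unfolded eq] eventually_mono[OF ev]]) (rule sym)
qed

lemma b_weight_limits:
  fixes W :: "real^'p^'p"
  assumes W: "trace W > 0" and exp: "resolvent_expansion W m r"
    and m: "(n - real CARD('p) - 1) * m + m^2 = 0"
    and L: "(n - 1) * real CARD('p) - 2 - r * (n - real CARD('p) - 1 + 2 * m - 1) = L"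
  shows "((\<lambda>c. b_weight n W c 0) \<longlongrightarrow> L) (at_right 0)
    \<and> ((\<lambda>c. b_weight n W (c * trace W) c) \<longlongrightarrow> L) (at_right 0)
    \<and> ((\<lambda>c. b_weight n W c 0) \<longlongrightarrow> -2) at_top
    \<and> ((\<lambda>c. b_weight n W (c * trace W) c) \<longlongrightarrow> 0) at_top"
proof (intro conjI)
  have id0: "((\<lambda>c. c) \<longlongrightarrow> 0) (at_right (0::real))"
    by (rule tendsto_ident_at)
  show "((\<lambda>c. b_weight n W c 0) \<longlongrightarrow> L) (at_right 0)"
    using tendsto_b_weight_at_right_0[OF exp m filterlim_ident tendsto_const] L by simp
  have "filterlim (\<lambda>c. c * trace W) (at_right 0) (at_right 0)"
    unfolding filterlim_at
  proof
    show "\<forall>\<^sub>F c in at_right 0. c * trace W \<in> {0<..} \<and> c * trace W \<noteq> 0"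
      using eventually_at_right_less[of "0::real"] by eventually_elim (use W in simp)
    show "((\<lambda>c. c * trace W) \<longlongrightarrow> 0) (at_right 0)"
      using tendsto_mult_left_zero[OF id0] by simp
  qed
  then show "((\<lambda>c. b_weight n W (c * trace W) c) \<longlongrightarrow> L) (at_right 0)"
    using tendsto_b_weight_at_right_0[OF exp m _ id0] L by simp
  have "((\<lambda>c. trace W * (2 * 0 + 1) / c) \<longlongrightarrow> 0) at_top"
    by (simp add: tendsto_divide_0[OF tendsto_const filterlim_at_top_imp_at_infinity[OF filterlim_ident]])
  then show "((\<lambda>c. b_weight n W c 0) \<longlongrightarrow> -2) at_top"
    using tendsto_b_weight_at_top[OF _ filterlim_ident, of W "\<lambda>c. 0" 0 n] W by simp
  have "((\<lambda>c::real. 2 + 1 / c) \<longlongrightarrow> 2 + 0) at_top"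
    by (intro tendsto_intros tendsto_divide_0[OF tendsto_const filterlim_at_top_imp_at_infinity[OF filterlim_ident]])
  moreover have "\<forall>\<^sub>F c in at_top. 2 + 1 / c = trace W * (2 * c + 1) / (c * trace W)"
    using eventually_gt_at_top[of "0::real"] by eventually_elim (use W in \<open>simp add: field_simps\<close>)
  ultimately have "((\<lambda>c. trace W * (2 * c + 1) / (c * trace W)) \<longlongrightarrow> 2) at_top"
    by (simp add: Lim_transform_eventually)
  moreover have "filterlim (\<lambda>c. c * trace W) at_top at_top"
    using filterlim_tendsto_pos_mult_at_top[OF tendsto_const W filterlim_ident] by (simp add: mult.commute)
  ultimately show "((\<lambda>c. b_weight n W (c * trace W) c) \<longlongrightarrow> 0) at_top"
    using tendsto_b_weight_at_top[of W "\<lambda>c. c * trace W" at_top "\<lambda>c. c" 2 n] W by simp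
qed

lemma AE_resolvent_expansion_Wmat:
  fixes Sigma :: "real^'p^'p"
  assumes n: "CARD('n) \<ge> 2" and S: "pos_def_mat Sigma"
  defines "L \<equiv> min ((real CARD('n) - 1)^2 + (real CARD('n) - 1) - 2)
    ((real CARD('p))^2 + real CARD('p) - 2)"
  shows "AE X in data_law Sigma Theta. 0 < trace (Wmat Sigma (X::real^'n^'p)) \<and> (\<exists>m r.
      resolvent_expansion (Wmat Sigma X) m r \<and>
      (real CARD('n) - real CARD('p) - 1) * m + m^2 = 0 \<and>
      (real CARD('n) - 1) * real CARD('p) - 2
        - r * (real CARD('n) - real CARD('p) - 1 + 2 * m - 1) = L)"
proof -
  let ?n = "real CARD('n)" and ?p = "real CARD('p)"
  show ?thesis
  proof (cases "CARD('p) < CARD('n)")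
    case True
    have "?p^2 \<le> (?n - 1)^2" using True by (intro power_mono) auto
    then have L: "(?n - 1) * ?p - 2 - ?p * (?n - ?p - 1 + 2 * 0 - 1) = L"
      using True by (simp add: L_def min_def power2_eq_square algebra_simps)
    show ?thesis
      using AE_det_centred_gram[OF True]
    proof eventually_elim
      case (elim X)
      then have "centred X \<noteq> 0" using det_0[where 'a=real and 'n='p] by auto
      with L show ?case
        by (intro conjI trace_Wmat_pos[OF S] exI[of _ 0] exI[of _ ?p]
            resolvent_expansion_Wmat_full_rank[OF S elim]) simp_all
    qed
  next
    case False
    have "(?n - 1)^2 \<le> ?p^2" using False by (intro power_mono) auto
    then have L: "(?n - 1) * ?p - 2 - (?n - 1) * (?n - ?p - 1 + 2 * (?p - (?n - 1)) - 1) = L"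
      using False by (simp add: L_def min_def power2_eq_square algebra_simps)
    have m: "(?n - ?p - 1) * (?p - (?n - 1)) + (?p - (?n - 1))^2 = 0"
      by (simp add: power2_eq_square algebra_simps)
    have np: "CARD('n) \<le> CARD('p)" using False by simp
    show ?thesis
      using AE_invertible_centred_gram_plus_averaging_mat[OF np pos_def_mat_matrix_inv[OF S]]
    proof eventually_elim
      case (elim X)
      then have "centred X \<noteq> 0"
        using det_averaging_mat[OF n] by (auto simp: invertible_det_nz)
      with L m show ?case
        by (intro conjI trace_Wmat_pos[OF S] exI[of _ "?p - (?n - 1)"] exI[of _ "?n - 1"]
            resolvent_expansion_Wmat_rank_deficient[OF S _ elim]) simp_all
    qed
  qed
qed

theorem proposition4:
  fixes Sigma :: "real^'p^'p" and Theta :: "real^'n^'p"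
  assumes "CARD('n) \<ge> 2"
    and "pos_def_mat Sigma"
    and "\<bar>real CARD('n) - real CARD('p) - 1\<bar> > 1"
  shows "AE X in data_law Sigma Theta.
     ((\<lambda>c. bS Sigma X c 0) \<longlongrightarrow>
         min ((real CARD('n) - 1)^2 + (real CARD('n) - 1) - 2)
             ((real CARD('p))^2 + real CARD('p) - 2)) (at_right 0)
   \<and> ((\<lambda>c. bS Sigma X (c * trace (Wmat Sigma X)) c) \<longlongrightarrow>
         min ((real CARD('n) - 1)^2 + (real CARD('n) - 1) - 2)
             ((real CARD('p))^2 + real CARD('p) - 2)) (at_right 0)
   \<and> ((\<lambda>c. bS Sigma X c 0) \<longlongrightarrow> -2) at_top
   \<and> ((\<lambda>c. bS Sigma X (c * trace (Wmat Sigma X)) c) \<longlongrightarrow> 0) at_top"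
proof -
  show ?thesis
    using AE_resolvent_expansion_Wmat[OF assms(1,2), where Theta=Theta] unfolding bS_eq_b_weight
  proof eventually_elim
    case (elim X)
    then obtain m r where "resolvent_expansion (Wmat Sigma X) m r"
      "(real CARD('n) - real CARD('p) - 1) * m + m^2 = 0"
      "(real CARD('n) - 1) * real CARD('p) - 2 - r * (real CARD('n) - real CARD('p) - 1 + 2 * m - 1)
        = min ((real CARD('n) - 1)^2 + (real CARD('n) - 1) - 2) ((real CARD('p))^2 + real CARD('p) - 2)"
      by blast
    with elim show ?case by (intro b_weight_limits) simp_all
  qed
qed

end
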